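(* Let $X$ be an infinite Hausdorff uniform space equipped with a continuous and topologically transitive action of a group $G$. Suppose in addition that the set of periodic points of $X$ (for the action of $G$) is dense in $X$. Then the action of $G$ on $X$ is sensitive.
   Context: A uniform space is a set $X$ equipped with a uniform structure $\mathcal{U}$ (in the sense of Weil), whose elements, which are subsets of $X \times X$, are called entourages. $X$ carries the induced topology, for which the neighborhoods of $x \in X$ are the sets $U[x] = \{y \in X : (x,y) \in U\}$, $U \in \mathcal{U}$. "Hausdorff" refers to this topology. $G$ is an abstract group with no topology. Continuous action: for each $g \in G$, the map $x \mapsto gx$ is continuous on $X$. Topologically transitive action: for any two non-empty open subsets $V, W$ of $X$, there exists $g \in G$ such that $gV \cap W \neq \varnothing$. Periodic point: a point $x \in X$ whose orbit $Gx = \{gx : g \in G\}$ is finite. Sensitive action: there is an entourage $U \in \mathcal{U}$ such that, for all $x \in X$ and every neighborhood $N$ of $x$, there exist a point $y \in N$ and an element $g \in G$ such that $(gx, gy) \notin U$. *)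

theory Defs
  imports "HOL-Analysis.Elementary_Topology" "HOL-Algebra.Group_Action"
begin

text \<open>
  The uniform space is a type of class \<^class>\<open>uniform_space\<close>; its entourages are the members of
  the filter \<^const>\<open>uniformity\<close>. An action of \<open>G\<close> on the whole type is
  \<open>group_action G UNIV \<phi>\<close>, with \<open>\<phi> g x\<close> standing for \<open>g x\<close>.
\<close>

definition entourage :: "('a::uniform_space \<times> 'a) set \<Rightarrow> bool"
  where "entourage U \<longleftrightarrow> eventually (\<lambda>p. p \<in> U) uniformity"

definition continuous_action ::
    "('g, 'm) monoid_scheme \<Rightarrow> ('g \<Rightarrow> 'a::topological_space \<Rightarrow> 'a) \<Rightarrow> bool"
  where "continuous_action G \<phi> \<longleftrightarrow>
    group_action G UNIV \<phi> \<and> (\<forall>g\<in>carrier G. continuous_on UNIV (\<phi> g))"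

definition topologically_transitive ::
    "('g, 'm) monoid_scheme \<Rightarrow> ('g \<Rightarrow> 'a::topological_space \<Rightarrow> 'a) \<Rightarrow> bool"
  where "topologically_transitive G \<phi> \<longleftrightarrow>
    (\<forall>V W. open V \<longrightarrow> V \<noteq> {} \<longrightarrow> open W \<longrightarrow> W \<noteq> {} \<longrightarrow>
      (\<exists>g\<in>carrier G. \<phi> g ` V \<inter> W \<noteq> {}))"

definition periodic_point ::
    "('g, 'm) monoid_scheme \<Rightarrow> ('g \<Rightarrow> 'a \<Rightarrow> 'a) \<Rightarrow> 'a \<Rightarrow> bool"
  where "periodic_point G \<phi> x \<longleftrightarrow> finite (orbit G \<phi> x)"

text \<open>A neighborhood of \<open>x\<close> is a member of \<open>nhds x\<close>; it need not be open.\<close>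

definition sensitive ::
    "('g, 'm) monoid_scheme \<Rightarrow> ('g \<Rightarrow> 'a::uniform_space \<Rightarrow> 'a) \<Rightarrow> bool"
  where "sensitive G \<phi> \<longleftrightarrow>
    (\<exists>U. entourage U \<and>
      (\<forall>x N. eventually (\<lambda>y. y \<in> N) (nhds x) \<longrightarrow>
        (\<exists>y\<in>N. \<exists>g\<in>carrier G. (\<phi> g x, \<phi> g y) \<notin> U)))"

end

theory Submission
  imports Defs
begin

text \<open>
  Infinitely many periodic points provide two disjoint finite orbits, and an entourage \<open>V\<close> such
  that every point \<open>x\<close> is not \<open>V\<close>-close to one of them. Let \<open>q\<close> lie in that orbit and let \<open>p\<close> be a
  periodic point close to \<open>x\<close>. Some \<open>y\<close> close to \<open>x\<close> is moved by some \<open>g\<close> so close to \<open>q\<close> that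
  \<open>k(gy)\<close> remains close to \<open>kq\<close> for the finitely many \<open>k\<close> that take the points of the orbit of \<open>p\<close>
  back to \<open>p\<close>. For the \<open>k\<close> with \<open>k(gp) = p\<close>, the element \<open>kg\<close> fixes \<open>p\<close>, which is near \<open>x\<close>, but
  takes \<open>y\<close> near \<open>kq\<close>, which is far from \<open>x\<close>.
\<close>

text \<open>Points are closed, so omitting one off-diagonal pair leaves an entourage; finitely many
  such entourages are intersected.\<close>

lemma eventually_uniformity_not_mem_prod:
  fixes A B :: "'a::{uniform_space, t1_space} set"
  assumes "finite A" "finite B" "A \<inter> B = {}"
  shows "eventually (\<lambda>p. p \<notin> A \<times> B) uniformity"
proof -
  have single: "eventually (\<lambda>p. p \<noteq> (a, b)) uniformity" if "a \<noteq> b" for a b :: 'a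
  proof -
    have "eventually (\<lambda>y. y \<in> - {b}) (nhds a)"
      using that by (intro eventually_nhds_in_open) auto
    then show ?thesis
      unfolding eventually_nhds_uniformity by (rule eventually_mono) auto
  qed
  have "eventually (\<lambda>p. \<forall>c\<in>A \<times> B. p \<noteq> c) uniformity"
    using assms by (intro eventually_ball_finite) (auto intro!: single)
  then show ?thesis
    by (rule eventually_mono) blast
qed

text \<open>Halve \<open>E\<close> twice, then intersect with the converse relation.\<close>

lemma uniformity_quarter:
  assumes "eventually E (uniformity :: ('a::uniform_space \<times> 'a) filter)"
  obtains D where "eventually D uniformity" "\<And>x y. D (x, y) \<Longrightarrow> D (y, x)"
    "\<And>v w x y z. D (v, w) \<Longrightarrow> D (w, x) \<Longrightarrow> D (x, y) \<Longrightarrow> D (y, z) \<Longrightarrow> E (v, z)"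
proof -
  obtain D1 where D1: "eventually D1 uniformity"
    "\<And>x y z. D1 (x, y) \<Longrightarrow> D1 (y, z) \<Longrightarrow> E (x, z)"
    using uniformity_transE[OF assms] by metis
  obtain D2 where D2: "eventually D2 uniformity"
    "\<And>x y z. D2 (x, y) \<Longrightarrow> D2 (y, z) \<Longrightarrow> D1 (x, z)"
    using uniformity_transE[OF D1(1)] by metis
  have "eventually (\<lambda>(x, y). D2 (y, x)) uniformity"
    using uniformity_sym[OF D2(1)] .
  with D2(1) have "eventually (\<lambda>(x, y). D2 (x, y) \<and> D2 (y, x)) uniformity"
    by eventually_elim auto
  then show thesis
    using that[of "\<lambda>(x, y). D2 (x, y) \<and> D2 (y, x)"] D1(2) D2(2) by auto metis
qed

theorem theorem1p2:
  fixes G :: "('g, 'm) monoid_scheme"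
    and \<phi> :: "'g \<Rightarrow> 'a::{uniform_space, t2_space} \<Rightarrow> 'a"
  assumes "infinite (UNIV :: 'a set)"
    and "continuous_action G \<phi>"
    and "topologically_transitive G \<phi>"
    and "closure {x. periodic_point G \<phi> x} = UNIV"
  shows "sensitive G \<phi>"
proof -
  interpret group_action G UNIV \<phi>
    using assms(2) by (simp add: continuous_action_def)
  interpret group G
    using group_hom by (rule group_hom.axioms)
  have cont: "continuous_on UNIV (\<phi> g)" if "g \<in> carrier G" for g
    using assms(2) that by (simp add: continuous_action_def)
  let ?P = "{x. periodic_point G \<phi> x}"
  \<comment> \<open>A finite set is closed here, so a finite dense \<open>?P\<close> would be the
    whole infinite space.\<close>
  have infP: "infinite ?P"
    using assms(1,4) finite_imp_closed closure_closed by metis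
  then obtain q1 where q1: "q1 \<in> ?P"
    by (metis finite.emptyI ex_in_conv)
  then have "infinite (?P - orbit G \<phi> q1)"
    using infP by (simp add: periodic_point_def)
  then obtain q2 where q2: "q2 \<in> ?P" "q2 \<notin> orbit G \<phi> q1"
    by (metis Diff_iff finite.emptyI ex_in_conv)
  have disj: "orbit G \<phi> q1 \<inter> orbit G \<phi> q2 = {}"
    using q2(2) orbit_sym orbit_trans by (metis UNIV_I disjoint_iff)
  let ?E = "\<lambda>p. p \<notin> orbit G \<phi> q1 \<times> orbit G \<phi> q2"
  have "eventually ?E uniformity"
    using q1 q2 disj by (intro eventually_uniformity_not_mem_prod) (auto simp: periodic_point_def)
  then obtain V where V: "eventually V uniformity" "\<And>x y. V (x, y) \<Longrightarrow> V (y, x)"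
    "\<And>v w x y z. V (v, w) \<Longrightarrow> V (w, x) \<Longrightarrow> V (x, y) \<Longrightarrow> V (y, z) \<Longrightarrow> ?E (v, z)"
    using uniformity_quarter by blast
  \<comment> \<open>\<open>U\<close> will witness sensitivity: four \<open>U\<close>-steps make one
    \<open>V\<close>-step.\<close>
  obtain U where U: "eventually U uniformity" "\<And>x y. U (x, y) \<Longrightarrow> U (y, x)"
    "\<And>v w x y z. U (v, w) \<Longrightarrow> U (w, x) \<Longrightarrow> U (x, y) \<Longrightarrow> U (y, z) \<Longrightarrow> V (v, z)"
    using uniformity_quarter[OF V(1)] by blast
  have far: "\<exists>q. finite (orbit G \<phi> q) \<and> (\<forall>z\<in>orbit G \<phi> q. \<not> V (x, z))" for x
  proof (rule ccontr)
    assume "\<not> ?thesis"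
    then obtain a b where "a \<in> orbit G \<phi> q1" "V (x, a)" "b \<in> orbit G \<phi> q2" "V (x, b)"
      using q1 q2(1) unfolding periodic_point_def mem_Collect_eq by blast
    \<comment> \<open>The chain \<open>a\<close>, \<open>x\<close>, \<open>x\<close>,
      \<open>x\<close>, \<open>b\<close>, padded by reflexivity, would put \<open>(a, b)\<close> in
      \<open>?E\<close>.\<close>
    then show False
      using V(2,3) uniformity_refl[OF V(1)] by blast
  qed
  have near: "eventually (\<lambda>y. U (x, y)) (nhds x)" for x
    unfolding eventually_nhds_uniformity using U(1) by (rule eventually_mono) auto
  have "\<exists>y\<in>N. \<exists>g\<in>carrier G. \<not> U (\<phi> g x, \<phi> g y)"
    if N: "eventually (\<lambda>y. y \<in> N) (nhds x)" for x N
  proof (rule ccontr)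
    assume "\<not> ?thesis"
    then have close: "U (\<phi> g x, \<phi> g y)" if "y \<in> N" "g \<in> carrier G" for y g
      using that by blast
    obtain q where q: "\<And>z. z \<in> orbit G \<phi> q \<Longrightarrow> \<not> V (x, z)"
      using far by blast
    have "eventually (\<lambda>y. y \<in> N \<and> U (x, y)) (nhds x)"
      using N near by (rule eventually_conj)
    then obtain S where S: "open S" "x \<in> S" "\<And>y. y \<in> S \<Longrightarrow> y \<in> N \<and> U (x, y)"
      unfolding eventually_nhds by blast
    have "x \<in> closure ?P"
      using assms(4) by simp
    then obtain p where p: "p \<in> ?P" "p \<in> S"
      using S(1,2) by (meson closure_iff_nhds_not_empty disjoint_iff order_refl)
    have "\<exists>k\<in>carrier G. \<phi> k z = p" if "z \<in> orbit G \<phi> p" for z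
      using orbit_sym[OF UNIV_I UNIV_I that] unfolding orbit_def by force
    then obtain k where k: "\<And>z. z \<in> orbit G \<phi> p \<Longrightarrow> k z \<in> carrier G \<and> \<phi> (k z) z = p"
      by metis
    \<comment> \<open>The element \<open>g\<close> is not known yet, so the neighborhood of
      \<open>q\<close> must serve every return element \<open>k z\<close>; finiteness of the orbit
      of \<open>p\<close> permits this.\<close>
    have "eventually (\<lambda>w. \<forall>z\<in>orbit G \<phi> p. U (\<phi> (k z) q, \<phi> (k z) w)) (nhds q)"
    proof (rule eventually_ball_finite)
      show "finite (orbit G \<phi> p)"
        using p(1) by (simp add: periodic_point_def)
      show "\<forall>z\<in>orbit G \<phi> p. eventually (\<lambda>w. U (\<phi> (k z) q, \<phi> (k z) w)) (nhds q)"
      proof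
        fix z assume "z \<in> orbit G \<phi> p"
        then have "isCont (\<phi> (k z)) q"
          using cont k by (simp add: continuous_on_eq_continuous_at)
        then have "filterlim (\<phi> (k z)) (nhds (\<phi> (k z) q)) (nhds q)"
          by (simp add: continuous_at tendsto_at_iff_tendsto_nhds)
        then show "eventually (\<lambda>w. U (\<phi> (k z) q, \<phi> (k z) w)) (nhds q)"
          using near by (auto simp: filterlim_iff)
      qed
    qed
    then obtain W where W: "open W" "q \<in> W"
      "\<And>w z. w \<in> W \<Longrightarrow> z \<in> orbit G \<phi> p \<Longrightarrow> U (\<phi> (k z) q, \<phi> (k z) w)"
      unfolding eventually_nhds by blast
    have "\<exists>g\<in>carrier G. \<phi> g ` S \<inter> W \<noteq> {}"
      using assms(3) S(1,2) W(1,2) unfolding topologically_transitive_def by blast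
    then obtain g y where g: "g \<in> carrier G" "y \<in> S" "\<phi> g y \<in> W"
      by blast
    \<comment> \<open>Since \<open>g\<close> moves \<open>p\<close> within its orbit,
      \<open>h\<close> is among the return elements that \<open>W\<close> was chosen for.\<close>
    define h where "h = k (\<phi> g p)"
    have gp: "\<phi> g p \<in> orbit G \<phi> p"
      using g(1) by (auto simp: orbit_def)
    have h: "h \<in> carrier G" "\<phi> h (\<phi> g p) = p"
      using k[OF gp] by (auto simp: h_def)
    have hg: "h \<otimes>\<^bsub>G\<^esub> g \<in> carrier G" "\<And>z. \<phi> (h \<otimes>\<^bsub>G\<^esub> g) z = \<phi> h (\<phi> g z)"
      using h(1) g(1) composition_rule by auto
    \<comment> \<open>Four links lead from \<open>x\<close> to \<open>\<phi> h q\<close>. The two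
      middle ones apply \<open>close\<close> to the product of \<open>h\<close> and
      \<open>g\<close>, which fixes \<open>p\<close>, at the points \<open>p\<close> and
      \<open>y\<close> of \<open>N\<close>.\<close>
    have "U (x, p)"
      using S(3) p(2) by blast
    moreover have "U (p, \<phi> h (\<phi> g x))"
      using close[OF _ hg(1), of p] S(3)[OF p(2)] U(2) hg(2) h(2) by simp
    moreover have "U (\<phi> h (\<phi> g x), \<phi> h (\<phi> g y))"
      using close[OF _ hg(1), of y] S(3)[OF g(2)] hg(2) by simp
    moreover have "U (\<phi> h (\<phi> g y), \<phi> h q)"
      using W(3)[OF g(3) gp] U(2) by (simp add: h_def)
    ultimately have "V (x, \<phi> h q)"
      by (rule U(3))
    moreover have "\<phi> h q \<in> orbit G \<phi> q"
      using h(1) by (auto simp: orbit_def)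
    ultimately show False
      using q by blast
  qed
  moreover have "entourage {p. U p}"
    using U(1) by (simp add: entourage_def)
  ultimately show ?thesis
    unfolding sensitive_def by (intro exI[of _ "{p. U p}"]) simp
qed

end
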